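(* Let $N$ be a finite set with $|N|\geq 3$, and let $\mathcal{S}:=\mathcal{B}\cup\{M\}$ be a min-semi-balanced set system on $N$, where $\mathcal{B}$ is a min-balanced set system on $M\subset N$, $|M|\geq 2$. Then the following two conditions are equivalent: (i) $\mathcal{B}$ is irreducible; (ii) $\mathcal{S}$ is indecomposable.
   Context: $\mathcal{P}(N)$ is the power set of $N$, $\subset$ is strict inclusion, and $\chi_S$ is the incidence vector of $S$. A constant vector in $\mathbb{R}^N$ is a vector $[r,\ldots,r]$, $r\in\mathbb{R}$. A linear combination is conic if all coefficients are $\geq 0$, and semi-conic if at most one coefficient is strictly negative. For a finite set $K$ with $|K|\geq 2$, a non-trivial set system on $K$ is a system $\mathcal{S}$ with $\emptyset\neq\mathcal{S}\subseteq\mathcal{P}(K)\setminus\{\emptyset,K\}$. It is balanced on $K$ if $\chi_K$ is a conic combination of $\{\chi_S:S\in\mathcal{S}\}$ with all coefficients non-zero. It is semi-balanced on $K$ if some constant vector in $\mathbb{R}^K$ is a semi-conic combination of $\{\chi_S:S\in\mathcal{S}\}$ with all coefficients non-zero. It is min-balanced (min-semi-balanced) on $K$ if it is balanced (semi-balanced) on $K$ and has no strict subsystem that is balanced (semi-balanced) on $K$. It is purely min-semi-balanced if it is min-semi-balanced and not balanced. A set $T\in\mathcal{S}$ is exceptional within a non-trivial system $\mathcal{S}$ on $N$ if there is a linear combination $\sum_{S\in\mathcal{S}}\lambda_S\chi_S$ yielding a constant vector in $\mathbb{R}^N$ with $\lambda_T<0$ and $\lambda_S\geq 0$ for $S\in\mathcal{S}\setminus\{T\}$.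 A purely min-semi-balanced system $\mathcal{S}$ on $N$ is indecomposable if there is no $E\subseteq N$ with $E\notin\mathcal{S}\cup\{\emptyset,N\}$ such that $E$ is exceptional within $\mathcal{S}\cup\{E\}$. A min-balanced system $\mathcal{B}$ on $M$ is reducible if there exists $\emptyset\neq E\subset M$ such that $\chi_E$ is a conic combination of $\{\chi_S:S\in\mathcal{B},\ S\subset E\}$; otherwise it is irreducible. *)

theory Defs
  imports Complex_Main "HOL-Library.Indicator_Function"
begin

text \<open>
  A vector in $\mathbb{R}^K$ is a function \<open>'a \<Rightarrow> real\<close> of which only the values on \<open>K\<close> matter;
  equality of vectors in $\mathbb{R}^K$ is therefore equality at every \<open>i \<in> K\<close>.
  The incidence vector of \<open>S\<close> is \<open>indicat_real S\<close>.
\<close>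

definition lin_comb :: "'a set set \<Rightarrow> ('a set \<Rightarrow> real) \<Rightarrow> 'a \<Rightarrow> real" where
  "lin_comb \<S> c i = (\<Sum>S\<in>\<S>. c S * indicat_real S i)"

definition constant_vec :: "'a set \<Rightarrow> ('a \<Rightarrow> real) \<Rightarrow> bool" where
  "constant_vec K x \<longleftrightarrow> (\<exists>r. \<forall>i\<in>K. x i = r)"

definition conic_coeffs :: "'a set set \<Rightarrow> ('a set \<Rightarrow> real) \<Rightarrow> bool" where
  "conic_coeffs \<S> c \<longleftrightarrow> (\<forall>S\<in>\<S>. 0 \<le> c S)"

text \<open>
  The set whose cardinality is taken is finite in all uses below, because \<open>\<S>\<close> is then a system of
  subsets of a finite set.
\<close>

definition semi_conic_coeffs :: "'a set set \<Rightarrow> ('a set \<Rightarrow> real) \<Rightarrow> bool" where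
  "semi_conic_coeffs \<S> c \<longleftrightarrow> card {S\<in>\<S>. c S < 0} \<le> 1"

definition nontrivial_system :: "'a set \<Rightarrow> 'a set set \<Rightarrow> bool" where
  "nontrivial_system K \<S> \<longleftrightarrow>
     finite K \<and> 2 \<le> card K \<and> \<S> \<noteq> {} \<and> \<S> \<subseteq> Pow K - {{}, K}"

definition balanced_on :: "'a set \<Rightarrow> 'a set set \<Rightarrow> bool" where
  "balanced_on K \<S> \<longleftrightarrow> nontrivial_system K \<S> \<and>
     (\<exists>c. conic_coeffs \<S> c \<and> (\<forall>S\<in>\<S>. c S \<noteq> 0) \<and>
          (\<forall>i\<in>K. lin_comb \<S> c i = indicat_real K i))"

definition semi_balanced_on :: "'a set \<Rightarrow> 'a set set \<Rightarrow> bool" where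
  "semi_balanced_on K \<S> \<longleftrightarrow> nontrivial_system K \<S> \<and>
     (\<exists>c. semi_conic_coeffs \<S> c \<and> (\<forall>S\<in>\<S>. c S \<noteq> 0) \<and> constant_vec K (lin_comb \<S> c))"

definition min_balanced_on :: "'a set \<Rightarrow> 'a set set \<Rightarrow> bool" where
  "min_balanced_on K \<S> \<longleftrightarrow> balanced_on K \<S> \<and> \<not> (\<exists>\<C>. \<C> \<subset> \<S> \<and> balanced_on K \<C>)"

definition min_semi_balanced_on :: "'a set \<Rightarrow> 'a set set \<Rightarrow> bool" where
  "min_semi_balanced_on K \<S> \<longleftrightarrow>
     semi_balanced_on K \<S> \<and> \<not> (\<exists>\<C>. \<C> \<subset> \<S> \<and> semi_balanced_on K \<C>)"

definition purely_min_semi_balanced_on :: "'a set \<Rightarrow> 'a set set \<Rightarrow> bool" where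
  "purely_min_semi_balanced_on K \<S> \<longleftrightarrow> min_semi_balanced_on K \<S> \<and> \<not> balanced_on K \<S>"

definition exceptional_within :: "'a set \<Rightarrow> 'a set set \<Rightarrow> 'a set \<Rightarrow> bool" where
  "exceptional_within N \<S> T \<longleftrightarrow> nontrivial_system N \<S> \<and> T \<in> \<S> \<and>
     (\<exists>c. constant_vec N (lin_comb \<S> c) \<and> c T < 0 \<and> (\<forall>S\<in>\<S> - {T}. 0 \<le> c S))"

definition indecomposable_on :: "'a set \<Rightarrow> 'a set set \<Rightarrow> bool" where
  "indecomposable_on N \<S> \<longleftrightarrow> purely_min_semi_balanced_on N \<S> \<and>
     \<not> (\<exists>E. E \<subseteq> N \<and> E \<notin> \<S> \<union> {{}, N} \<and> exceptional_within N (\<S> \<union> {E}) E)"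

definition reducible_on :: "'a set \<Rightarrow> 'a set set \<Rightarrow> bool" where
  "reducible_on M \<B> \<longleftrightarrow> min_balanced_on M \<B> \<and>
     (\<exists>E. E \<noteq> {} \<and> E \<subset> M \<and>
        (\<exists>c. conic_coeffs {S\<in>\<B>. S \<subset> E} c \<and>
             (\<forall>i\<in>M. lin_comb {S\<in>\<B>. S \<subset> E} c i = indicat_real E i)))"

definition irreducible_on :: "'a set \<Rightarrow> 'a set set \<Rightarrow> bool" where
  "irreducible_on M \<B> \<longleftrightarrow> min_balanced_on M \<B> \<and> \<not> reducible_on M \<B>"

end

theory Submission
  imports Defs
begin

text \<open>
  All members of \<open>\<B> \<union> {M}\<close> avoid the points of \<open>N - M\<close>. Hence, if \<open>E\<close> is exceptional within
  \<open>\<B> \<union> {M, E}\<close>, comparing the values on \<open>N - M\<close> and on \<open>N - E\<close> forces the constant to be zero and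
  \<open>E\<close> to be a subset of \<open>M\<close>; dividing by the negative coefficient of \<open>E\<close> then gives a reduction.
  Conversely, a reduction with \<open>E \<in> \<B>\<close> would allow one to eliminate \<open>E\<close> from \<open>\<B>\<close>, contradicting
  minimality, so \<open>E \<notin> \<B>\<close> and the reduction shows that \<open>E\<close> is exceptional.
\<close>

lemma lin_comb_nonneg:
  assumes "conic_coeffs \<S> c"
  shows "0 \<le> lin_comb \<S> c i"
  using assms by (auto simp: lin_comb_def conic_coeffs_def intro!: sum_nonneg)

lemma lin_comb_outside:
  assumes "\<And>S. S \<in> \<S> \<Longrightarrow> i \<notin> S"
  shows "lin_comb \<S> c i = 0"
  using assms by (auto simp: lin_comb_def intro!: sum.neutral)

lemma lin_comb_ge_member:
  assumes "finite \<S>" "conic_coeffs \<S> c" "S \<in> \<S>" "i \<in> S"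
  shows "c S \<le> lin_comb \<S> c i"
  using member_le_sum[of S \<S> "\<lambda>S. c S * indicat_real S i"] assms
  by (auto simp: lin_comb_def conic_coeffs_def)

lemma lin_comb_insert:
  assumes "finite \<S>" "E \<notin> \<S>"
  shows "lin_comb (insert E \<S>) c i = c E * indicat_real E i + lin_comb \<S> c i"
  using assms by (simp add: lin_comb_def)

lemma lin_comb_restrict:
  assumes "finite \<S>" "\<And>S. S \<in> \<S> \<Longrightarrow> S \<notin> \<T> \<Longrightarrow> c S = 0" "\<T> \<subseteq> \<S>"
  shows "lin_comb \<T> c i = lin_comb \<S> c i"
  unfolding lin_comb_def by (rule sum.mono_neutral_left) (use assms in auto)

lemma nontrivial_system_finite:
  assumes "nontrivial_system K \<S>"
  shows "finite \<S>"
  using assms unfolding nontrivial_system_def by (meson Diff_subset finite_Pow_iff finite_subset)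

text \<open>A balanced system must use every set with a non-zero coefficient, so the sets with
  coefficient zero are discarded. This brings minimality to bear on representations in which some
  coefficients vanish.\<close>

lemma conic_imp_balanced_subsystem:
  assumes "nontrivial_system K \<S>" "conic_coeffs \<S> c"
    and eq: "\<And>i. i \<in> K \<Longrightarrow> lin_comb \<S> c i = indicat_real K i"
  shows "balanced_on K {S\<in>\<S>. c S \<noteq> 0}"
proof -
  let ?\<T> = "{S\<in>\<S>. c S \<noteq> 0}"
  have lc: "lin_comb ?\<T> c i = lin_comb \<S> c i" for i
    by (rule lin_comb_restrict) (use nontrivial_system_finite[OF assms(1)] in auto)
  have "K \<noteq> {}"
    using assms(1) by (auto simp: nontrivial_system_def)
  then obtain i where "i \<in> K" by auto
  then have "lin_comb ?\<T> c i \<noteq> 0"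
    using eq lc by simp
  then have "?\<T> \<noteq> {}"
    unfolding lin_comb_def by (metis sum.empty)
  then have "nontrivial_system K ?\<T>"
    using assms(1) by (auto simp: nontrivial_system_def)
  moreover have "conic_coeffs ?\<T> c"
    using assms(2) by (auto simp: conic_coeffs_def)
  ultimately show ?thesis
    unfolding balanced_on_def using eq lc by auto
qed

text \<open>Substituting the representation of \<open>E\<close> into a balancing combination of
  \<open>\<S>\<close> gives a conic representation of the incidence vector of \<open>K\<close> that
  avoids \<open>E\<close>, against minimality.\<close>

lemma min_balanced_not_conic_comb_of_others:
  assumes mb: "min_balanced_on K \<S>" and E: "E \<in> \<S>" and c: "conic_coeffs (\<S> - {E}) c"
    and eq: "\<And>i. i \<in> K \<Longrightarrow> lin_comb (\<S> - {E}) c i = indicat_real E i"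
  shows False
proof -
  let ?\<T> = "\<S> - {E}"
  have nt: "nontrivial_system K \<S>"
    using mb by (simp add: min_balanced_on_def balanced_on_def)
  have fin: "finite ?\<T>"
    using nontrivial_system_finite[OF nt] by simp
  obtain b where b: "conic_coeffs \<S> b"
    and beq: "\<And>i. i \<in> K \<Longrightarrow> lin_comb \<S> b i = indicat_real K i"
    using mb by (auto simp: min_balanced_on_def balanced_on_def)
  \<comment> \<open>These are the coefficients after the substitution. The value 0 at
    \<open>E\<close> is what makes the support of \<open>d\<close> a strict subsystem.\<close>
  define d where "d S = (if S \<in> ?\<T> then b S + b E * c S else 0)" for S
  have d: "conic_coeffs \<S> d"
    using b c E by (auto simp: conic_coeffs_def d_def)
  have "lin_comb \<S> d i = indicat_real K i" if i: "i \<in> K" for i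
  proof -
    have "lin_comb \<S> d i = lin_comb ?\<T> d i"
      by (rule lin_comb_restrict[symmetric])
        (use nontrivial_system_finite[OF nt] in \<open>auto simp: d_def\<close>)
    also have "\<dots> = lin_comb ?\<T> b i + b E * lin_comb ?\<T> c i"
      by (simp add: lin_comb_def d_def sum.distrib sum_distrib_left algebra_simps)
    also have "\<dots> = lin_comb (insert E ?\<T>) b i"
      using lin_comb_insert[OF fin, of E b i] eq[OF i] by simp
    finally show ?thesis
      using beq[OF i] E by (simp add: insert_absorb)
  qed
  from conic_imp_balanced_subsystem[OF nt d this]
  have "balanced_on K {S\<in>\<S>. d S \<noteq> 0}" .
  moreover have "{S\<in>\<S>. d S \<noteq> 0} \<subset> \<S>"
    using E by (auto simp: d_def)
  ultimately show False
    using mb by (auto simp: min_balanced_on_def)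
qed

lemma exceptional_imp_reducible:
  assumes "M \<subset> N" and mb: "min_balanced_on M \<B>"
    and E: "E \<subseteq> N" "E \<notin> \<B> \<union> {M} \<union> {{}, N}"
    and exc: "exceptional_within N (\<B> \<union> {M} \<union> {E}) E"
  shows "reducible_on M \<B>"
proof -
  let ?\<S> = "\<B> \<union> {M}"
  have nt: "nontrivial_system M \<B>"
    using mb by (simp add: min_balanced_on_def balanced_on_def)
  then have sub: "\<And>S. S \<in> ?\<S> \<Longrightarrow> S \<subseteq> M" and fin: "finite ?\<S>"
    using nontrivial_system_finite by (auto simp: nontrivial_system_def)
  obtain c r where const: "\<forall>i\<in>N. lin_comb (?\<S> \<union> {E}) c i = r"
    and neg: "c E < 0" and "\<forall>S\<in>(?\<S> \<union> {E}) - {E}. 0 \<le> c S"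
    using exc unfolding exceptional_within_def constant_vec_def by blast
  then have pos: "\<And>S. S \<in> ?\<S> \<Longrightarrow> 0 \<le> c S"
    using E by blast
  have conic: "conic_coeffs ?\<S> c"
    using pos by (simp add: conic_coeffs_def)
  have r: "c E * indicat_real E i + lin_comb ?\<S> c i = r" if "i \<in> N" for i
    using bspec[OF const that] lin_comb_insert[OF fin, of E c i] E by auto
  have out: "lin_comb ?\<S> c i = 0" if "i \<notin> M" for i
    by (rule lin_comb_outside) (use sub that in auto)
  \<comment> \<open>As \<open>E\<close> is not \<open>N\<close>, there is a point where the negative
    term vanishes; there \<open>r\<close> is a value of a conic combination.\<close>
  obtain k where k: "k \<in> N" "k \<notin> E"
    using E by auto
  then have r0: "0 \<le> r"
    using r[of k] lin_comb_nonneg[OF conic, of k] by simp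
  \<comment> \<open>At a point of \<open>E\<close> outside \<open>M\<close> only the term of
    \<open>E\<close> survives, so \<open>r = c E < 0\<close>, contrary to \<open>r0\<close>.\<close>
  have EM: "E \<subseteq> M"
  proof
    fix i assume "i \<in> E"
    then show "i \<in> M"
      using r[of i] out[of i] r0 neg E(1) by (cases "i \<in> M") auto
  qed
  obtain j where "j \<in> N" "j \<notin> M"
    using \<open>M \<subset> N\<close> by auto
  then have rz: "r = 0"
    using r[of j] out[of j] EM by (auto simp: indicator_def)
  \<comment> \<open>Since \<open>E \<notin> ?\<S>\<close>, such an \<open>S\<close> has a point
    outside \<open>E\<close>. There a sum of nonnegative terms equals \<open>r = 0\<close>, so the
    term \<open>c S\<close> vanishes. This applies to \<open>M\<close> too, leaving only sets of
    \<open>\<B>\<close> strictly inside \<open>E\<close>.\<close>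
  have zero: "c S = 0" if S: "S \<in> ?\<S>" "\<not> S \<subset> E" for S
  proof -
    obtain i where i: "i \<in> S" "i \<notin> E"
      using S E by auto
    moreover have "i \<in> N"
      using i sub[OF S(1)] \<open>M \<subset> N\<close> by auto
    ultimately show ?thesis
      using r[of i] rz lin_comb_ge_member[OF fin conic S(1) i(1)] pos[OF S(1)] by simp
  qed
  let ?\<T> = "{S\<in>\<B>. S \<subset> E}"
  define d where "d S = c S / (- c E)" for S
  have lc: "lin_comb ?\<T> c i = lin_comb ?\<S> c i" for i
    by (rule lin_comb_restrict[OF fin]) (use zero EM in auto)
  have "lin_comb ?\<T> d i = indicat_real E i" if "i \<in> M" for i
  proof -
    have "lin_comb ?\<T> d i = lin_comb ?\<T> c i / (- c E)"
      by (simp add: lin_comb_def d_def sum_divide_distrib sum_negf)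
    also have "lin_comb ?\<T> c i = - c E * indicat_real E i"
      using r[of i] rz lc that \<open>M \<subset> N\<close> by auto
    finally show ?thesis
      using neg by simp
  qed
  moreover have "conic_coeffs ?\<T> d"
    using neg pos by (auto simp: conic_coeffs_def d_def divide_nonneg_neg)
  moreover have "E \<noteq> {}" "E \<subset> M"
    using E EM by auto
  ultimately show ?thesis
    unfolding reducible_on_def using mb by blast
qed

lemma reducible_imp_exceptional:
  assumes "finite N" and "M \<subset> N" and red: "reducible_on M \<B>"
  obtains E where "E \<subseteq> N" "E \<notin> \<B> \<union> {M} \<union> {{}, N}"
    "exceptional_within N (\<B> \<union> {M} \<union> {E}) E"
proof -
  have mb: "min_balanced_on M \<B>"
    using red by (simp add: reducible_on_def)
  then have nt: "nontrivial_system M \<B>"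
    by (simp add: min_balanced_on_def balanced_on_def)
  then have fin: "finite \<B>" and sub: "\<And>S. S \<in> \<B> \<Longrightarrow> S \<subseteq> M"
    using nontrivial_system_finite by (auto simp: nontrivial_system_def)
  obtain E c where E: "E \<noteq> {}" "E \<subset> M" and c: "conic_coeffs {S\<in>\<B>. S \<subset> E} c"
    and ceq: "\<And>i. i \<in> M \<Longrightarrow> lin_comb {S\<in>\<B>. S \<subset> E} c i = indicat_real E i"
    using red by (auto simp: reducible_on_def)
  \<comment> \<open>Extending \<open>c\<close> by zero lets the same coefficients serve over
    \<open>\<B> - {E}\<close> and over \<open>\<B> \<union> {M}\<close>.\<close>
  define d where "d S = (if S \<in> \<B> \<and> S \<subset> E then c S else 0)" for S
  have dpos: "0 \<le> d S" for S
    using c by (auto simp: conic_coeffs_def d_def)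
  have deq: "lin_comb \<T> d i = indicat_real E i"
    if \<T>: "{S\<in>\<B>. S \<subset> E} \<subseteq> \<T>" "finite \<T>" for \<T> i
  proof -
    have "lin_comb \<T> d i = lin_comb {S\<in>\<B>. S \<subset> E} d i"
      by (rule lin_comb_restrict[symmetric]) (use \<T> in \<open>auto simp: d_def\<close>)
    also have "\<dots> = lin_comb {S\<in>\<B>. S \<subset> E} c i"
      by (simp add: lin_comb_def d_def)
    also have "\<dots> = indicat_real E i"
    proof (cases "i \<in> M")
      \<comment> \<open>Reducibility gives the equality on \<open>M\<close> only; off
        \<open>M\<close> both sides are zero, because \<open>E\<close> and all sets of
        \<open>\<B>\<close> lie in \<open>M\<close>.\<close>
      case False
      then have "lin_comb {S\<in>\<B>. S \<subset> E} c i = 0"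
        by (intro lin_comb_outside) (use sub in auto)
      then show ?thesis
        using False E by (auto simp: indicator_def)
    qed (rule ceq)
    finally show ?thesis .
  qed
  \<comment> \<open>The representation uses only strict subsets of \<open>E\<close>, so it survives
    the removal of \<open>E\<close> from \<open>\<B>\<close>.\<close>
  have EB: "E \<notin> \<B>"
  proof
    assume "E \<in> \<B>"
    moreover have "conic_coeffs (\<B> - {E}) d"
      using dpos by (simp add: conic_coeffs_def)
    moreover have "lin_comb (\<B> - {E}) d i = indicat_real E i" for i
      by (rule deq) (use fin in auto)
    ultimately show False
      by (rule min_balanced_not_conic_comb_of_others[OF mb])
  qed
  \<comment> \<open>The coefficient -1 cancels the incidence vector represented by \<open>d\<close>,
    so the constant vector obtained is zero.\<close>
  define f where "f = d(E := -1)"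
  have "lin_comb (\<B> \<union> {M} \<union> {E}) f i = 0" for i
  proof -
    have "lin_comb (\<B> \<union> {M}) f i = lin_comb (\<B> \<union> {M}) d i"
      unfolding lin_comb_def by (rule sum.cong) (use E EB in \<open>auto simp: f_def\<close>)
    then show ?thesis
      using lin_comb_insert[of "\<B> \<union> {M}" E f i] deq[of "\<B> \<union> {M}" i] fin E EB
      by (auto simp: f_def)
  qed
  then have "constant_vec N (lin_comb (\<B> \<union> {M} \<union> {E}) f)"
    by (simp add: constant_vec_def)
  moreover have "f E < 0" "\<forall>S\<in>(\<B> \<union> {M} \<union> {E}) - {E}. 0 \<le> f S"
    using dpos by (auto simp: f_def)
  moreover have "nontrivial_system N (\<B> \<union> {M} \<union> {E})"
  proof -
    have "2 \<le> card N"
      using nt card_mono[of N M] assms by (auto simp: nontrivial_system_def)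
    moreover have "\<B> \<union> {M} \<union> {E} \<subseteq> Pow N - {{}, N}"
      using nt E \<open>M \<subset> N\<close> by (auto simp: nontrivial_system_def)
    ultimately show ?thesis
      using \<open>finite N\<close> by (simp add: nontrivial_system_def)
  qed
  ultimately have "exceptional_within N (\<B> \<union> {M} \<union> {E}) E"
    unfolding exceptional_within_def by blast
  moreover have "E \<subseteq> N" "E \<notin> \<B> \<union> {M} \<union> {{}, N}"
    using E EB \<open>M \<subset> N\<close> by auto
  ultimately show thesis
    using that by blast
qed

text \<open>Every combination vanishes on \<open>N - M\<close>, where the incidence vector of
  \<open>N\<close> is 1. This supplies the purity that indecomposability demands.\<close>

lemma not_balanced_on_superset:
  assumes "M \<subset> N" "\<And>S. S \<in> \<S> \<Longrightarrow> S \<subseteq> M"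
  shows "\<not> balanced_on N \<S>"
proof
  assume "balanced_on N \<S>"
  then obtain c where c: "\<And>i. i \<in> N \<Longrightarrow> lin_comb \<S> c i = indicat_real N i"
    by (auto simp: balanced_on_def)
  obtain j where j: "j \<in> N" "j \<notin> M"
    using assms(1) by auto
  have "lin_comb \<S> c j = 0"
    by (rule lin_comb_outside) (use assms(2) j in auto)
  then show False
    using c[OF j(1)] j by simp
qed

theorem lemma19:
  fixes N M :: "'a set" and \<B> :: "'a set set"
  assumes "finite N" and "3 \<le> card N"
    and "M \<subset> N" and "2 \<le> card M"
    and "min_balanced_on M \<B>"
    and "min_semi_balanced_on N (\<B> \<union> {M})"
  shows "irreducible_on M \<B> \<longleftrightarrow> indecomposable_on N (\<B> \<union> {M})"
proof -
  have "\<not> balanced_on N (\<B> \<union> {M})"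
    by (rule not_balanced_on_superset[OF assms(3)])
      (use assms(5) in \<open>auto simp: min_balanced_on_def balanced_on_def nontrivial_system_def\<close>)
  then have "purely_min_semi_balanced_on N (\<B> \<union> {M})"
    using assms(6) by (simp add: purely_min_semi_balanced_on_def)
  moreover have "reducible_on M \<B> \<longleftrightarrow>
      (\<exists>E. E \<subseteq> N \<and> E \<notin> \<B> \<union> {M} \<union> {{}, N} \<and> exceptional_within N (\<B> \<union> {M} \<union> {E}) E)"
    using exceptional_imp_reducible[OF assms(3,5)] reducible_imp_exceptional[OF assms(1,3)]
    by metis
  ultimately show ?thesis
    unfolding irreducible_on_def indecomposable_on_def using assms(5) by blast
qed

end
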